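(* Let $n\geq 1$ be an integer. Let $X=X_n$ be the $n\times n$ matrix whose $(i,j)$ entry equals $\min(i,j,n-i+1,n-j+1)$, and let $D'$ be the unique $n\times n$ diagonal matrix such that each row of $D'+X$ sums to $\binom{n+1}{2}$. The spectrum of (the adjacency matrix of) $\mathrm{SR}_n$ contains the following eigenvalues: (1) the eigenvalues of $D'+X$ and of $D'-X$; (2) $\mu+n$, where $\mu$ is any eigenvalue of (the adjacency matrix of) the reversal graph $R_n$.
   Context: A signed permutation of degree $n$ is an $n$-tuple $(\sigma_1,\dots,\sigma_n)$ of integers such that $(|\sigma_1|,\dots,|\sigma_n|)$ is a permutation of $\{1,\dots,n\}$. The signed reversal graph $\mathrm{SR}_n$ is the graph whose vertices are the signed permutations of degree $n$, where $\sigma=(\sigma_1,\dots,\sigma_n)$ and $\tau=(\tau_1,\dots,\tau_n)$ are adjacent if there exist $1\leq i\leq j\leq n$ such that $(\tau_1,\dots,\tau_n)=(\sigma_1,\dots,\sigma_{i-1},-\sigma_j,-\sigma_{j-1},\dots,-\sigma_i,\sigma_{j+1},\dots,\sigma_n)$. The reversal graph $R_n$ is the (simple) graph whose vertices are the permutations $(\pi_1,\dots,\pi_n)$ of $\{1,\dots,n\}$, where two distinct permutations are adjacent if one is obtained from the other by reversing a substring, i.e. $(\pi_1,\dots,\pi_n)$ is adjacent to $(\pi_1,\dots,\pi_{i-1},\pi_j,\pi_{j-1},\dots,\pi_i,\pi_{j+1},\dots,\pi_n)$ for $1\leq i<j\leq n$. *)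

theory Defs
  imports
    "HOL-Combinatorics.Multiset_Permutations"
    "Jordan_Normal_Form.Spectral_Radius"
begin

definition signed_perms :: "nat \<Rightarrow> int list set" where
  "signed_perms n = {\<sigma>. map abs \<sigma> \<in> permutations_of_set {1..int n}}"

text \<open>Positions \<open>i \<le> j\<close> of the reversed segment are counted from 1.\<close>

definition reversal :: "nat \<Rightarrow> nat \<Rightarrow> 'a list \<Rightarrow> 'a list" where
  "reversal i j xs = take (i - 1) xs @ rev (drop (i - 1) (take j xs)) @ drop j xs"

definition signed_reversal :: "nat \<Rightarrow> nat \<Rightarrow> int list \<Rightarrow> int list" where
  "signed_reversal i j xs =
     take (i - 1) xs @ map uminus (rev (drop (i - 1) (take j xs))) @ drop j xs"

definition SR_adj :: "nat \<Rightarrow> int list \<Rightarrow> int list \<Rightarrow> bool" where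
  "SR_adj n \<sigma> \<tau> \<longleftrightarrow> (\<exists>i j. 1 \<le> i \<and> i \<le> j \<and> j \<le> n \<and> \<tau> = signed_reversal i j \<sigma>)"

definition R_adj :: "nat \<Rightarrow> nat list \<Rightarrow> nat list \<Rightarrow> bool" where
  "R_adj n \<pi> \<rho> \<longleftrightarrow> \<pi> \<noteq> \<rho> \<and> (\<exists>i j. 1 \<le> i \<and> i < j \<and> j \<le> n \<and> \<rho> = reversal i j \<pi>)"

text \<open>
  The list \<open>vs\<close> fixes the order of the rows and columns; it is meant to enumerate the vertex set
  without repetition. The matrices here are real symmetric; taking complex entries means that
  \<^const>\<open>spectrum\<close> contains every eigenvalue with no appeal to this fact.
\<close>

definition adjacency_mat :: "'v list \<Rightarrow> ('v \<Rightarrow> 'v \<Rightarrow> bool) \<Rightarrow> complex mat" where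
  "adjacency_mat vs E = mat (length vs) (length vs) (\<lambda>(i, j). if E (vs ! i) (vs ! j) then 1 else 0)"

text \<open>
  Matrix indices start at 0, so row \<open>i\<close> and column \<open>j\<close> below are row \<open>i + 1\<close> and
  column \<open>j + 1\<close> in the usual numbering, and \<open>n - (i + 1) + 1 = n - i\<close>.
\<close>

definition X_mat :: "nat \<Rightarrow> complex mat" where
  "X_mat n = mat n n (\<lambda>(i, j). of_nat (Min {i + 1, j + 1, n - i, n - j}))"

definition is_D' :: "nat \<Rightarrow> complex mat \<Rightarrow> bool" where
  "is_D' n D \<longleftrightarrow> D \<in> carrier_mat n n \<and> diagonal_mat D \<and>
     (\<forall>i<n. (\<Sum>j<n. (D + X_mat n) $$ (i, j)) = of_nat ((n + 1) choose 2))"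

definition D'_mat :: "nat \<Rightarrow> complex mat" where
  "D'_mat n = (THE D. is_D' n D)"

lemma ex1_D': "\<exists>!D. is_D' n D"
proof -
  let ?b = "of_nat ((n + 1) choose 2) :: complex"
  define r where "r i = (\<Sum>j<n. X_mat n $$ (i, j))" for i
  have row: "(\<Sum>j<n. (D + X_mat n) $$ (i, j)) = D $$ (i, i) + r i"
    if D: "D \<in> carrier_mat n n" "diagonal_mat D" and i: "i < n" for D i
  proof -
    have "(\<Sum>j<n. (D + X_mat n) $$ (i, j)) = (\<Sum>j<n. D $$ (i, j) + X_mat n $$ (i, j))"
      using D i by (intro sum.cong) (auto simp: X_mat_def)
    also have "\<dots> = (\<Sum>j<n. D $$ (i, j)) + r i"
      by (simp add: sum.distrib r_def)
    also have "(\<Sum>j<n. D $$ (i, j)) = (\<Sum>j<n. if j = i then D $$ (i, i) else 0)"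
      using D i by (intro sum.cong) (auto simp: diagonal_mat_def)
    also have "\<dots> = D $$ (i, i)" using i by simp
    finally show ?thesis .
  qed
  show ?thesis
  proof (rule ex1I)
    let ?D = "mat n n (\<lambda>(i, j). if i = j then ?b - r i else 0)"
    have "?D \<in> carrier_mat n n" "diagonal_mat ?D" by (auto simp: diagonal_mat_def)
    then show "is_D' n ?D" unfolding is_D'_def by (simp add: row)
  next
    fix D assume D: "is_D' n D"
    then have "D $$ (i, i) = ?b - r i" if "i < n" for i
      using row[of D i] that unfolding is_D'_def by (simp add: algebra_simps)
    then show "D = mat n n (\<lambda>(i, j). if i = j then ?b - r i else 0)"
      using D unfolding is_D'_def by (intro eq_matI) (auto simp: diagonal_mat_def)
  qed
qed

lemma is_D'_D'_mat: "is_D' n (D'_mat n)"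
  unfolding D'_mat_def by (rule theI') (rule ex1_D')

lemma finite_signed_perms: "finite (signed_perms n)"
proof (rule finite_subset)
  show "signed_perms n \<subseteq> {\<sigma>. set \<sigma> \<subseteq> {- int n..int n} \<and> length \<sigma> = n}"
  proof (rule subsetI)
    fix \<sigma> assume "\<sigma> \<in> signed_perms n"
    then have s: "abs ` set \<sigma> = {1..int n}" and d: "distinct (map abs \<sigma>)"
      by (auto simp: signed_perms_def permutations_of_set_def)
    have "length \<sigma> = n" using distinct_card[OF d] s by simp
    moreover have "\<bar>x\<bar> \<in> {1..int n}" if "x \<in> set \<sigma>" for x
      using that s by blast
    then have "set \<sigma> \<subseteq> {- int n..int n}" by fastforce
    ultimately show "\<sigma> \<in> {\<sigma>. set \<sigma> \<subseteq> {- int n..int n} \<and> length \<sigma> = n}" by simp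
  qed
qed (rule finite_lists_length_eq, simp)

end

theory Submission imports Defs begin

text \<open>
  Every eigenvalue is obtained by pulling a function back to the signed permutations. The
  neighbours of a signed permutation \<open>\<sigma>\<close> correspond bijectively to the intervals \<open>[i, j]\<close> of
  positions (\<open>sum_SR_neighbours\<close>), so \<open>f\<close> is an eigenfunction for \<open>\<nu>\<close> as soon as the sum of its
  values over the signed reversals of \<open>\<sigma>\<close>, one for each interval, is \<open>\<nu> * f \<sigma>\<close>.

  For \<open>D' + X\<close> and \<open>D' - X\<close>, let \<open>f \<sigma>\<close> depend only on the position \<open>p\<close> and the sign of the entry
  \<open>1\<close> or \<open>-1\<close> of \<open>\<sigma>\<close>: it is \<open>w p\<close> for the entry \<open>1\<close> and \<open>\<epsilon> * w p\<close> for the entry \<open>-1\<close>, with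
  \<open>\<epsilon> = 1\<close> or \<open>\<epsilon> = -1\<close>. Reversing \<open>[i, j]\<close> leaves \<open>f \<sigma>\<close> as it is if \<open>p\<close> lies outside \<open>[i, j]\<close>;
  otherwise the entry moves to \<open>i + j - p\<close> and changes its sign, which contributes a factor \<open>\<epsilon>\<close>.
  The number of intervals that carry \<open>p\<close> to \<open>q\<close> is the entry \<open>X\<^sub>p\<^sub>q\<close> (\<open>card_intervals_mirror\<close>).
  There are \<open>(n + 1) choose 2\<close> intervals, and those containing \<open>p\<close> are counted by row \<open>p\<close> of \<open>X\<close>, so
  the number of intervals that avoid \<open>p\<close> is the diagonal entry of \<open>D'\<close> (\<open>D'_mat_diag\<close>).
  Hence the adjacency operator of the signed reversal graph acts on \<open>w\<close> as \<open>D' + \<epsilon> X\<close>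
  (\<open>sum_intervals_D'_X\<close>), and eigenvectors \<open>w\<close> of this matrix yield eigenfunctions \<open>f\<close>.

  For the reversal graph, let \<open>f \<sigma> = g \<bar>\<sigma>\<bar>\<close> where \<open>g\<close> is an eigenfunction. Taking absolute values
  turns signed reversals into reversals. The intervals with \<open>i < j\<close> contribute \<open>\<mu> * g \<bar>\<sigma>\<bar>\<close>, and the
  \<open>n\<close> intervals with \<open>i = j\<close> only change a sign and contribute \<open>g \<bar>\<sigma>\<bar>\<close> each
  (\<open>spectrum_R_plus_n_SR\<close>).
\<close>

section \<open>Counting intervals\<close>

text \<open>Positions count from 0 here, so the interval \<open>(i, j)\<close> gives rise to \<^term>\<open>reversal (Suc i) (Suc j)\<close>.\<close>

definition intervals :: "nat \<Rightarrow> (nat \<times> nat) set" where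
  "intervals n = {(i, j). i \<le> j \<and> j < n}"

lemma intervals_Sigma: "intervals n = (\<lambda>(j, i). (i, j)) ` (SIGMA j:{..<n}. {..j})"
  by (auto simp: intervals_def)

lemma finite_intervals [simp]: "finite (intervals n)"
  by (simp add: intervals_Sigma)

lemma card_intervals: "card (intervals n) = (n + 1) choose 2"
proof -
  have "card (intervals n) = (\<Sum>j<n. Suc j)"
    unfolding intervals_Sigma by (subst card_image) (auto simp: inj_on_def)
  also have "\<dots> = (n + 1) choose 2"
    by (induction n) (simp_all add: numeral_2_eq_2)
  finally show ?thesis .
qed

text \<open>
  An interval that is mirrored onto itself with \<open>p\<close> going to \<open>q\<close> satisfies \<open>i + j = p + q\<close>, so it is
  determined by \<open>i\<close>. The condition \<open>p \<le> j\<close> amounts to \<open>i \<le> q\<close>, and \<open>j < n\<close> to \<open>p + q < i + n\<close>.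
\<close>

lemma card_intervals_mirror:
  assumes "p < n" "q < n"
  shows "card {(i, j) \<in> intervals n. i \<le> p \<and> p \<le> j \<and> i + j - p = q}
    = Min {p + 1, q + 1, n - p, n - q}"
proof -
  have "{(i, j) \<in> intervals n. i \<le> p \<and> p \<le> j \<and> i + j - p = q}
    = (\<lambda>i. (i, p + q - i)) ` {p + q + 1 - n..min p q}"
    using assms by (auto simp: intervals_def image_iff)
  then have "card {(i, j) \<in> intervals n. i \<le> p \<and> p \<le> j \<and> i + j - p = q}
    = min p q + 1 - (p + q + 1 - n)"
    by (simp add: card_image inj_on_def)
  also have "\<dots> = Min {p + 1, q + 1, n - p, n - q}"
    using assms by (auto simp: min_def)
  finally show ?thesis .
qed

lemma sum_intervals_containing:
  fixes v :: "nat \<Rightarrow> complex"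
  assumes p: "p < n"
  shows "(\<Sum>(i, j) \<in> {(i, j) \<in> intervals n. i \<le> p \<and> p \<le> j}. v (i + j - p))
    = (\<Sum>q<n. X_mat n $$ (p, q) * v q)"
proof -
  let ?C = "{(i, j) \<in> intervals n. i \<le> p \<and> p \<le> j}"
  have fin: "finite ?C" by (rule finite_subset[OF _ finite_intervals]) auto
  have img: "(\<lambda>(i, j). i + j - p) ` ?C \<subseteq> {..<n}" by (auto simp: intervals_def)
  have "(\<Sum>(i, j) \<in> ?C. v (i + j - p))
      = (\<Sum>q<n. \<Sum>x \<in> {x \<in> ?C. (\<lambda>(i, j). i + j - p) x = q}. (\<lambda>(i, j). v (i + j - p)) x)"
    by (rule sum.group[OF fin _ img, symmetric]) simp
  also have "\<dots> = (\<Sum>q<n. X_mat n $$ (p, q) * v q)"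
  proof (rule sum.cong[OF refl])
    fix q assume q: "q \<in> {..<n}"
    have "{x \<in> ?C. (\<lambda>(i, j). i + j - p) x = q}
        = {(i, j) \<in> intervals n. i \<le> p \<and> p \<le> j \<and> i + j - p = q}" by auto
    moreover have "(\<Sum>x \<in> {x \<in> ?C. (\<lambda>(i, j). i + j - p) x = q}. (\<lambda>(i, j). v (i + j - p)) x)
        = (\<Sum>x \<in> {x \<in> ?C. (\<lambda>(i, j). i + j - p) x = q}. v q)"
      by (rule sum.cong) auto
    ultimately show "(\<Sum>x \<in> {x \<in> ?C. (\<lambda>(i, j). i + j - p) x = q}. (\<lambda>(i, j). v (i + j - p)) x)
        = X_mat n $$ (p, q) * v q"
      using p q by (simp add: card_intervals_mirror X_mat_def del: Min_insert)
  qed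
  finally show ?thesis .
qed

text \<open>
  Summing \<open>X\<close> along row \<open>p\<close> counts each interval containing \<open>p\<close> once, by the mirror image of \<open>p\<close>.
  The row sum prescribed for \<open>D' + X\<close> is the number of all intervals, which leaves the intervals
  avoiding \<open>p\<close> for the diagonal.
\<close>

lemma D'_mat_diag:
  assumes p: "p < n"
  shows "D'_mat n $$ (p, p) = of_nat (card {(i, j) \<in> intervals n. \<not> (i \<le> p \<and> p \<le> j)})"
proof -
  let ?C = "{(i, j) \<in> intervals n. i \<le> p \<and> p \<le> j}"
  let ?N = "{(i, j) \<in> intervals n. \<not> (i \<le> p \<and> p \<le> j)}"
  have D: "D'_mat n \<in> carrier_mat n n" "diagonal_mat (D'_mat n)"
    "(\<Sum>q<n. (D'_mat n + X_mat n) $$ (p, q)) = of_nat ((n + 1) choose 2)"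
    using is_D'_D'_mat[of n] p unfolding is_D'_def by blast+
  have "(\<Sum>q<n. (D'_mat n + X_mat n) $$ (p, q))
      = (\<Sum>q<n. (if q = p then D'_mat n $$ (p, p) else 0) + X_mat n $$ (p, q))"
    using D(1,2) p by (intro sum.cong) (auto simp: X_mat_def diagonal_mat_def)
  also have "\<dots> = D'_mat n $$ (p, p) + (\<Sum>q<n. X_mat n $$ (p, q))"
    using p by (simp add: sum.distrib)
  also have "(\<Sum>q<n. X_mat n $$ (p, q)) = of_nat (card ?C)"
    using sum_intervals_containing[OF p, of "\<lambda>_. 1"] by (simp add: case_prod_unfold)
  finally have eq: "D'_mat n $$ (p, p) + of_nat (card ?C) = of_nat (card (intervals n))"
    using D(3) by (simp add: card_intervals)
  have "card (intervals n) = card ?N + card ?C"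
    by (subst card_Un_disjoint[symmetric])
       (auto intro: finite_subset[OF _ finite_intervals] intro!: arg_cong[where f = card])
  then show ?thesis using eq by simp
qed

text \<open>
  The left-hand side is what the adjacency operator does to a weight \<open>v\<close> that depends on the
  position \<open>p\<close> of one entry, where \<open>\<epsilon>\<close> accounts for the change of sign.
\<close>

lemma sum_intervals_D'_X:
  fixes v :: "nat \<Rightarrow> complex"
  assumes p: "p < n"
  shows "(\<Sum>(i, j) \<in> intervals n. if i \<le> p \<and> p \<le> j then \<epsilon> * v (i + j - p) else v p)
    = (\<Sum>q<n. (D'_mat n + \<epsilon> \<cdot>\<^sub>m X_mat n) $$ (p, q) * v q)"
proof -
  let ?C = "{(i, j) \<in> intervals n. i \<le> p \<and> p \<le> j}"
  let ?N = "{(i, j) \<in> intervals n. \<not> (i \<le> p \<and> p \<le> j)}"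
  let ?F = "\<lambda>(i, j). if i \<le> p \<and> p \<le> j then \<epsilon> * v (i + j - p) else v p"
  have fin: "finite ?C" "finite ?N" by (auto intro: finite_subset[OF _ finite_intervals])
  have D: "D'_mat n \<in> carrier_mat n n" "diagonal_mat (D'_mat n)"
    using is_D'_D'_mat[of n] unfolding is_D'_def by blast+
  have "intervals n = ?N \<union> ?C" by auto
  then have "sum ?F (intervals n) = sum ?F (?N \<union> ?C)" by simp
  also have "\<dots> = sum ?F ?N + sum ?F ?C"
    by (rule sum.union_disjoint) (use fin in auto)
  also have "sum ?F ?N = (\<Sum>x \<in> ?N. v p)" by (rule sum.cong) auto
  also have "\<dots> = D'_mat n $$ (p, p) * v p" using p by (simp add: D'_mat_diag)
  also have "sum ?F ?C = (\<Sum>x \<in> ?C. \<epsilon> * (case x of (i, j) \<Rightarrow> v (i + j - p)))"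
    by (rule sum.cong) auto
  also have "\<dots> = \<epsilon> * (\<Sum>q<n. X_mat n $$ (p, q) * v q)"
    by (simp add: sum_distrib_left[symmetric] sum_intervals_containing[OF p, symmetric])
  also have "D'_mat n $$ (p, p) * v p + \<epsilon> * (\<Sum>q<n. X_mat n $$ (p, q) * v q)
      = (\<Sum>q<n. (if q = p then D'_mat n $$ (p, p) * v p else 0) + \<epsilon> * X_mat n $$ (p, q) * v q)"
    using p by (simp add: sum.distrib sum_distrib_left mult.assoc)
  also have "\<dots> = (\<Sum>q<n. (D'_mat n + \<epsilon> \<cdot>\<^sub>m X_mat n) $$ (p, q) * v q)"
    using D p by (intro sum.cong) (auto simp: X_mat_def diagonal_mat_def algebra_simps)
  finally show ?thesis .
qed

section \<open>Reversals of lists\<close>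

lemma length_reversal: "i \<le> j \<Longrightarrow> length (reversal (Suc i) (Suc j) xs) = length xs"
  by (simp add: reversal_def)

lemma nth_reversal:
  assumes "i \<le> j" "j < length xs" "k < length xs"
  shows "reversal (Suc i) (Suc j) xs ! k = (if i \<le> k \<and> k \<le> j then xs ! (i + j - k) else xs ! k)"
  using assms by (auto simp: reversal_def nth_append rev_nth intro!: arg_cong[where f = "nth xs"])

lemma nth_signed_reversal:
  assumes "i \<le> j" "j < length xs" "k < length xs"
  shows "signed_reversal (Suc i) (Suc j) xs ! k
    = (if i \<le> k \<and> k \<le> j then - xs ! (i + j - k) else xs ! k)"
  using assms by (auto simp: signed_reversal_def nth_append rev_nth intro!: arg_cong[where f = "nth xs"])

lemma mset_reversal:
  assumes "i \<le> j"
  shows "mset (reversal (Suc i) (Suc j) xs) = mset xs"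
proof -
  have "mset (reversal (Suc i) (Suc j) xs)
      = mset ((take i (take (Suc j) xs) @ drop i (take (Suc j) xs)) @ drop (Suc j) xs)"
    using assms unfolding reversal_def by (simp add: min_def)
  then show ?thesis by (simp only: append_take_drop_id)
qed

lemma reversal_permutations_of_set:
  assumes "i \<le> j" "xs \<in> permutations_of_set A"
  shows "reversal (Suc i) (Suc j) xs \<in> permutations_of_set A"
  using assms mset_reversal[OF assms(1), of xs]
  by (metis mset_eq_imp_distinct_iff mset_eq_setD permutations_of_setD permutations_of_setI)

lemma map_reversal: "map f (reversal i j xs) = reversal i j (map f xs)"
  by (simp add: reversal_def take_map drop_map rev_map)

lemma map_signed_reversal:
  assumes "\<And>x. f (- x) = f x"
  shows "map f (signed_reversal i j xs) = reversal i j (map f xs)"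
  using assms by (simp add: signed_reversal_def reversal_def take_map drop_map rev_map comp_def)

section \<open>Eigenfunctions of a graph\<close>

text \<open>
  This replaces eigenvectors, which are indexed by places in the list \<open>vs\<close>, by functions on
  the vertices, so that the chosen enumeration disappears from the arguments that follow.
\<close>

lemma spectrum_adjacency_mat_iff:
  assumes "distinct vs"
  shows "\<nu> \<in> spectrum (adjacency_mat vs E) \<longleftrightarrow>
    (\<exists>f. (\<exists>x \<in> set vs. f x \<noteq> 0) \<and>
      (\<forall>x \<in> set vs. (\<Sum>y | y \<in> set vs \<and> E x y. f y) = \<nu> * f x))"
proof -
  let ?A = "adjacency_mat vs E" and ?m = "length vs"
  have nbr: "(?A *\<^sub>v vec ?m (\<lambda>k. f (vs ! k))) $ a = (\<Sum>y | y \<in> set vs \<and> E (vs ! a) y. f y)"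
    if a: "a < ?m" for f a
  proof -
    have "(?A *\<^sub>v vec ?m (\<lambda>k. f (vs ! k))) $ a
        = (\<Sum>b<?m. if E (vs ! a) (vs ! b) then f (vs ! b) else 0)"
      using a by (auto simp: adjacency_mat_def scalar_prod_def lessThan_atLeast0 intro!: sum.cong)
    also have "\<dots> = (\<Sum>y \<in> set vs. if E (vs ! a) y then f y else 0)"
      using sum.reindex_bij_betw[OF bij_betw_nth[OF assms refl refl],
          of "\<lambda>y. if E (vs ! a) y then f y else 0"] by simp
    also have "\<dots> = (\<Sum>y | y \<in> set vs \<and> E (vs ! a) y. f y)"
      by (simp add: sum.inter_filter)
    finally show ?thesis .
  qed
  show ?thesis
  proof
    assume "\<nu> \<in> spectrum ?A"
    then obtain v where v: "v \<in> carrier_vec ?m" "v \<noteq> 0\<^sub>v ?m" "?A *\<^sub>v v = \<nu> \<cdot>\<^sub>v v"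
      by (auto simp: spectrum_def eigenvalue_def eigenvector_def adjacency_mat_def)
    define f where "f x = v $ the_inv_into {..<?m} ((!) vs) x" for x
    have f: "f (vs ! k) = v $ k" if "k < ?m" for k
      using that assms by (simp add: f_def the_inv_into_f_f inj_on_def nth_eq_iff_index_eq)
    have vf: "v = vec ?m (\<lambda>k. f (vs ! k))" using v(1) f by auto
    have "\<exists>k<?m. v $ k \<noteq> 0"
      using v(1,2) by (metis eq_vecI carrier_vecD index_zero_vec)
    then have "\<exists>x \<in> set vs. f x \<noteq> 0" using f by (metis nth_mem)
    moreover have "(\<Sum>y | y \<in> set vs \<and> E x y. f y) = \<nu> * f x" if x: "x \<in> set vs" for x
    proof -
      obtain a where a: "a < ?m" "x = vs ! a" using x by (auto simp: in_set_conv_nth)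
      have "(?A *\<^sub>v v) $ a = \<nu> * v $ a" unfolding v(3) using v(1) a(1) by simp
      then show ?thesis using nbr[OF a(1), of f] a(2) f[OF a(1)] vf[symmetric] by simp
    qed
    ultimately show "\<exists>f. (\<exists>x \<in> set vs. f x \<noteq> 0) \<and>
      (\<forall>x \<in> set vs. (\<Sum>y | y \<in> set vs \<and> E x y. f y) = \<nu> * f x)" by blast
  next
    assume "\<exists>f. (\<exists>x \<in> set vs. f x \<noteq> 0) \<and>
      (\<forall>x \<in> set vs. (\<Sum>y | y \<in> set vs \<and> E x y. f y) = \<nu> * f x)"
    then obtain f where f: "\<exists>x \<in> set vs. f x \<noteq> 0"
      "\<And>x. x \<in> set vs \<Longrightarrow> (\<Sum>y | y \<in> set vs \<and> E x y. f y) = \<nu> * f x" by blast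
    let ?v = "vec ?m (\<lambda>k. f (vs ! k))"
    obtain k where k: "k < ?m" "f (vs ! k) \<noteq> 0" using f(1) by (auto simp: in_set_conv_nth)
    have "?v \<noteq> 0\<^sub>v ?m" using k by (metis index_vec index_zero_vec(1))
    moreover have "?A *\<^sub>v ?v = \<nu> \<cdot>\<^sub>v ?v"
    proof (rule eq_vecI)
      fix a assume "a < dim_vec (\<nu> \<cdot>\<^sub>v ?v)"
      then have a: "a < ?m" by simp
      show "(?A *\<^sub>v ?v) $ a = (\<nu> \<cdot>\<^sub>v ?v) $ a"
        unfolding nbr[OF a] using a f(2) by simp
    qed (simp add: adjacency_mat_def)
    ultimately have "eigenvector ?A ?v \<nu>"
      by (simp add: eigenvector_def adjacency_mat_def)
    then show "\<nu> \<in> spectrum ?A" by (auto simp: spectrum_def eigenvalue_def)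
  qed
qed

section \<open>Neighbours in the two reversal graphs\<close>

lemma signed_permsD:
  assumes "\<sigma> \<in> signed_perms n"
  shows "length \<sigma> = n" and "\<And>k. k < n \<Longrightarrow> \<sigma> ! k \<noteq> 0" and "distinct (map abs \<sigma>)"
proof -
  have s: "map abs \<sigma> \<in> permutations_of_set {1..int n}" using assms by (simp add: signed_perms_def)
  show l: "length \<sigma> = n" using length_finite_permutations_of_set[OF s] by simp
  show "distinct (map abs \<sigma>)" using permutations_of_setD(2)[OF s] .
  have "abs ` set \<sigma> = {1..int n}" using permutations_of_setD(1)[OF s] by simp
  then have "\<bar>\<sigma> ! k\<bar> \<in> {1..int n}" if "k < n" for k
    using that l by (metis imageI nth_mem)
  then show "\<sigma> ! k \<noteq> 0" if "k < n" for k using that by force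
qed

text \<open>
  A signed reversal changes exactly the entries in its interval: an entry of a signed permutation
  is neither its own negative nor that of another entry. The interval can thus be read off from
  the result, so different intervals give different neighbours.
\<close>

lemma sum_SR_neighbours:
  fixes f :: "int list \<Rightarrow> complex"
  assumes \<sigma>: "\<sigma> \<in> signed_perms n"
  shows "(\<Sum>\<tau> | \<tau> \<in> signed_perms n \<and> SR_adj n \<sigma> \<tau>. f \<tau>)
    = (\<Sum>(i, j) \<in> intervals n. f (signed_reversal (Suc i) (Suc j) \<sigma>))"
proof -
  let ?r = "\<lambda>(i, j). signed_reversal (Suc i) (Suc j) \<sigma>"
  have changed: "?r (i, j) ! k \<noteq> \<sigma> ! k \<longleftrightarrow> i \<le> k \<and> k \<le> j"
    if "(i, j) \<in> intervals n" "k < n" for i j k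
  proof -
    have "- \<sigma> ! l \<noteq> \<sigma> ! k" if l: "l < n" for l
    proof
      assume eq: "- \<sigma> ! l = \<sigma> ! k"
      then have "map abs \<sigma> ! l = map abs \<sigma> ! k"
        using l \<open>k < n\<close> signed_permsD(1)[OF \<sigma>] by (metis abs_minus_cancel nth_map)
      then have "l = k"
        using l \<open>k < n\<close> signed_permsD(1,3)[OF \<sigma>] by (simp only: nth_eq_iff_index_eq length_map)
      then show False using eq l signed_permsD(2)[OF \<sigma>, of l] by simp
    qed
    moreover have "i + j - k < n" if "i \<le> k"
      using that \<open>(i, j) \<in> intervals n\<close> by (auto simp: intervals_def)
    ultimately show ?thesis
      using that signed_permsD(1)[OF \<sigma>] by (simp add: intervals_def nth_signed_reversal)
  qed
  have "inj_on ?r (intervals n)"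
  proof (rule inj_onI)
    fix x y assume xy: "x \<in> intervals n" "y \<in> intervals n" "?r x = ?r y"
    obtain i j i' j' where x: "x = (i, j)" and y: "y = (i', j')" by (metis surj_pair)
    have ij: "(i, j) \<in> intervals n" "(i', j') \<in> intervals n"
      and eq: "?r (i, j) = ?r (i', j')" using xy unfolding x y .
    have *: "i \<le> k \<and> k \<le> j \<longleftrightarrow> i' \<le> k \<and> k \<le> j'" if "k < n" for k
      using changed[OF ij(1) that] changed[OF ij(2) that] eq by metis
    from ij show "x = y"
      unfolding x y using *[of i] *[of j] *[of i'] *[of j'] by (auto simp: intervals_def)
  qed
  moreover have "{\<tau>. \<tau> \<in> signed_perms n \<and> SR_adj n \<sigma> \<tau>} = ?r ` intervals n"
  proof (intro Set.set_eqI iffI)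
    fix \<tau> assume "\<tau> \<in> {\<tau>. \<tau> \<in> signed_perms n \<and> SR_adj n \<sigma> \<tau>}"
    then obtain i j where "1 \<le> i" "i \<le> j" "j \<le> n" "\<tau> = signed_reversal i j \<sigma>"
      by (auto simp: SR_adj_def)
    then show "\<tau> \<in> ?r ` intervals n"
      by (intro image_eqI[where x = "(i - 1, j - 1)"]) (auto simp: intervals_def)
  next
    fix \<tau> assume "\<tau> \<in> ?r ` intervals n"
    then obtain i j where ij: "i \<le> j" "j < n" "\<tau> = signed_reversal (Suc i) (Suc j) \<sigma>"
      by (auto simp: intervals_def)
    have "\<tau> \<in> signed_perms n"
      using \<sigma> ij by (simp add: signed_perms_def map_signed_reversal reversal_permutations_of_set)
    moreover have "SR_adj n \<sigma> \<tau>"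
      unfolding SR_adj_def using ij by (intro exI[of _ "Suc i"] exI[of _ "Suc j"]) auto
    ultimately show "\<tau> \<in> {\<tau>. \<tau> \<in> signed_perms n \<and> SR_adj n \<sigma> \<tau>}" by simp
  qed
  ultimately show ?thesis by (simp add: sum.reindex case_prod_unfold)
qed

text \<open>
  Without signs, the entry in the middle of an interval of odd length stays in place. If \<open>i < j\<close>,
  then the first and the last changed position are still \<open>i\<close> and \<open>j\<close>, which makes the result
  differ from \<open>\<pi>\<close> and determine the interval.
\<close>

lemma sum_R_neighbours:
  fixes f :: "nat list \<Rightarrow> complex"
  assumes \<pi>: "\<pi> \<in> permutations_of_set {1..n}"
  shows "(\<Sum>\<rho> | \<rho> \<in> permutations_of_set {1..n} \<and> R_adj n \<pi> \<rho>. f \<rho>)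
    = (\<Sum>(i, j) \<in> {(i, j) \<in> intervals n. i \<noteq> j}. f (reversal (Suc i) (Suc j) \<pi>))"
proof -
  let ?r = "\<lambda>(i, j). reversal (Suc i) (Suc j) \<pi>"
  let ?I = "{(i, j) \<in> intervals n. i \<noteq> j}"
  have len: "length \<pi> = n" using length_finite_permutations_of_set[OF \<pi>] by simp
  have changed: "?r (i, j) ! k \<noteq> \<pi> ! k \<longleftrightarrow> i \<le> k \<and> k \<le> j \<and> i + j \<noteq> 2 * k"
    if "(i, j) \<in> ?I" "k < n" for i j k
    using that len permutations_of_setD(2)[OF \<pi>]
    by (auto simp: intervals_def nth_reversal nth_eq_iff_index_eq)
  have "inj_on ?r ?I"
  proof (rule inj_onI)
    fix x y assume xy: "x \<in> ?I" "y \<in> ?I" "?r x = ?r y"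
    obtain i j i' j' where x: "x = (i, j)" and y: "y = (i', j')" by (metis surj_pair)
    have ij: "(i, j) \<in> ?I" "(i', j') \<in> ?I" and eq: "?r (i, j) = ?r (i', j')"
      using xy unfolding x y .
    have *: "i \<le> k \<and> k \<le> j \<and> i + j \<noteq> 2 * k \<longleftrightarrow> i' \<le> k \<and> k \<le> j' \<and> i' + j' \<noteq> 2 * k"
      if "k < n" for k
      using changed[OF ij(1) that] changed[OF ij(2) that] eq by metis
    from ij show "x = y"
      unfolding x y using *[of i] *[of j] *[of i'] *[of j'] by (auto simp: intervals_def)
  qed
  moreover have "{\<rho>. \<rho> \<in> permutations_of_set {1..n} \<and> R_adj n \<pi> \<rho>} = ?r ` ?I"
  proof (intro Set.set_eqI iffI)
    fix \<rho> assume "\<rho> \<in> {\<rho>. \<rho> \<in> permutations_of_set {1..n} \<and> R_adj n \<pi> \<rho>}"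
    then obtain i j where "1 \<le> i" "i < j" "j \<le> n" "\<rho> = reversal i j \<pi>"
      by (auto simp: R_adj_def)
    then show "\<rho> \<in> ?r ` ?I"
      by (intro image_eqI[where x = "(i - 1, j - 1)"]) (auto simp: intervals_def)
  next
    fix \<rho> assume "\<rho> \<in> ?r ` ?I"
    then obtain i j where "(i, j) \<in> ?I" and \<rho>: "\<rho> = reversal (Suc i) (Suc j) \<pi>"
      by auto
    then have ij: "i < j" "j < n" "\<rho> = reversal (Suc i) (Suc j) \<pi>"
      by (simp_all add: intervals_def)
    have "\<rho> ! i \<noteq> \<pi> ! i" using changed[of i j i] ij by (auto simp: intervals_def)
    then have "R_adj n \<pi> \<rho>"
      unfolding R_adj_def using ij by (intro conjI exI[of _ "Suc i"] exI[of _ "Suc j"]) auto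
    then show "\<rho> \<in> {\<rho>. \<rho> \<in> permutations_of_set {1..n} \<and> R_adj n \<pi> \<rho>}"
      using ij \<pi> by (simp add: reversal_permutations_of_set)
  qed
  ultimately show ?thesis by (simp add: sum.reindex case_prod_unfold)
qed

section \<open>The eigenvalues of \<open>D' + X\<close> and \<open>D' - X\<close>\<close>

text \<open>
  Moving the entries of \<open>\<sigma>\<close> against fixed weights is the same as moving the weights against fixed
  entries; each sign change turns into a factor \<open>\<epsilon>\<close>. This separates \<open>\<sigma>\<close> from the interval, so that
  the sum over intervals can be evaluated for each position on its own.
\<close>

lemma sum_signed_reversal:
  fixes h :: "int \<Rightarrow> complex"
  assumes ij: "(i, j) \<in> intervals n" and len: "length \<sigma> = n"
    and h: "\<And>x. h (- x) = \<epsilon> * h x"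
  shows "(\<Sum>k<n. h (signed_reversal (Suc i) (Suc j) \<sigma> ! k) * v k)
    = (\<Sum>p<n. h (\<sigma> ! p) * (if i \<le> p \<and> p \<le> j then \<epsilon> * v (i + j - p) else v p))"
proof -
  define m where "m k = (if i \<le> k \<and> k \<le> j then i + j - k else k)" for k
  have inv: "m (m k) = k" for k by (auto simp: m_def)
  have less: "m k \<in> {..<n}" if "k \<in> {..<n}" for k
    using that ij by (auto simp: m_def intervals_def)
  have val: "h (\<sigma> ! m k) * (if i \<le> m k \<and> m k \<le> j then \<epsilon> * v (i + j - m k) else v (m k))
      = h (signed_reversal (Suc i) (Suc j) \<sigma> ! k) * v k" if "k \<in> {..<n}" for k
    using that ij len h by (auto simp: m_def intervals_def nth_signed_reversal)
  show ?thesis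
    by (rule sum.reindex_bij_witness[where i = m and j = m]) (use inv less val in blast)+
qed

text \<open>This shows that the eigenfunction built from a nonzero vector does not vanish identically.\<close>

lemma signed_perm_with_1_at:
  assumes "p < n"
  obtains \<sigma> where "\<sigma> \<in> signed_perms n" "\<And>k. k < n \<Longrightarrow> \<bar>\<sigma> ! k\<bar> = 1 \<longleftrightarrow> k = p" "\<sigma> ! p = 1"
proof
  \<comment> \<open>Reversing the first \<open>p + 1\<close> entries of the identity moves \<open>1\<close> to position \<open>p\<close>.\<close>
  let ?\<sigma> = "reversal (Suc 0) (Suc p) [1..int n]"
  have id: "[1..int n] \<in> permutations_of_set {1..int n}" by (auto intro: permutations_of_setI)
  have perm: "?\<sigma> \<in> permutations_of_set {1..int n}"
    by (rule reversal_permutations_of_set[OF le0 id])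
  have "set ?\<sigma> = {1..int n}" by (rule permutations_of_setD(1)[OF perm])
  then have abs: "map abs ?\<sigma> = ?\<sigma>" by (intro map_idI) auto
  then show s: "?\<sigma> \<in> signed_perms n" using perm by (simp add: signed_perms_def)
  show p: "?\<sigma> ! p = 1" using assms by (simp add: nth_reversal nth_upto)
  show "\<bar>?\<sigma> ! k\<bar> = 1 \<longleftrightarrow> k = p" if "k < n" for k
  proof -
    have "\<bar>?\<sigma> ! k\<bar> = ?\<sigma> ! k" using arg_cong[OF abs, of "\<lambda>xs. xs ! k"] that signed_permsD(1)[OF s] by simp
    then show ?thesis
      using p that assms permutations_of_setD(2)[OF perm] signed_permsD(1)[OF s]
      by (metis nth_eq_iff_index_eq)
  qed
qed

lemma mult_mat_vec_nth:
  fixes A :: "complex mat"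
  assumes "A \<in> carrier_mat m n" "w \<in> carrier_vec n" "k < m"
  shows "(A *\<^sub>v w) $ k = (\<Sum>q<n. A $$ (k, q) * w $ q)"
  using assms by (simp add: scalar_prod_def lessThan_atLeast0)

text \<open>
  The assumption on \<open>\<epsilon>\<close> means \<open>\<epsilon> = 1\<close> or \<open>\<epsilon> = -1\<close>; it is what makes the factor \<open>\<epsilon>\<close> appear also when
  the entry \<open>-1\<close> turns back into \<open>1\<close>.
\<close>

lemma spectrum_D'_X_subset_SR:
  assumes vs: "distinct vs" "set vs = signed_perms n" and \<epsilon>: "\<epsilon> * \<epsilon> = 1"
  shows "spectrum (D'_mat n + \<epsilon> \<cdot>\<^sub>m X_mat n) \<subseteq> spectrum (adjacency_mat vs (SR_adj n))"
proof
  let ?M = "D'_mat n + \<epsilon> \<cdot>\<^sub>m X_mat n"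
  fix \<nu> assume "\<nu> \<in> spectrum ?M"
  moreover have M: "?M \<in> carrier_mat n n" by (simp add: X_mat_def)
  ultimately obtain w where w: "w \<in> carrier_vec n" "w \<noteq> 0\<^sub>v n" "?M *\<^sub>v w = \<nu> \<cdot>\<^sub>v w"
    by (auto simp: spectrum_def eigenvalue_def eigenvector_def X_mat_def)
  obtain p where p: "p < n" "w $ p \<noteq> 0"
    using w(1,2) by (metis eq_vecI carrier_vecD index_zero_vec)
  define h :: "int \<Rightarrow> complex" where "h x = (if x = 1 then 1 else if x = -1 then \<epsilon> else 0)" for x
  have h: "h (- x) = \<epsilon> * h x" for x using \<epsilon> by (auto simp: h_def)
  \<comment> \<open>Only the entry \<open>1\<close> or \<open>-1\<close> of \<open>\<sigma>\<close> contributes, but the sum is linear in \<open>w\<close> and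
    can be interchanged with the sum over intervals.\<close>
  define f where "f \<sigma> = (\<Sum>k<n. h (\<sigma> ! k) * w $ k)" for \<sigma>
  have row: "(\<Sum>q<n. ?M $$ (k, q) * w $ q) = \<nu> * w $ k" if "k < n" for k
  proof -
    have "(\<Sum>q<n. ?M $$ (k, q) * w $ q) = (?M *\<^sub>v w) $ k"
      using mult_mat_vec_nth[OF M w(1) that] by simp
    also have "\<dots> = \<nu> * w $ k" unfolding w(3) using w(1) that by simp
    finally show ?thesis .
  qed
  have "(\<Sum>\<tau> | \<tau> \<in> set vs \<and> SR_adj n \<sigma> \<tau>. f \<tau>) = \<nu> * f \<sigma>" if "\<sigma> \<in> set vs" for \<sigma>
  proof -
    have \<sigma>: "\<sigma> \<in> signed_perms n" using that vs(2) by simp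
    let ?g = "\<lambda>i j p. if i \<le> p \<and> p \<le> j then \<epsilon> * w $ (i + j - p) else w $ p"
    have "(\<Sum>\<tau> | \<tau> \<in> set vs \<and> SR_adj n \<sigma> \<tau>. f \<tau>)
        = (\<Sum>(i, j) \<in> intervals n. f (signed_reversal (Suc i) (Suc j) \<sigma>))"
      unfolding vs(2) by (rule sum_SR_neighbours[OF \<sigma>])
    also have "\<dots> = (\<Sum>(i, j) \<in> intervals n. \<Sum>p<n. h (\<sigma> ! p) * ?g i j p)"
      unfolding f_def
      by (rule sum.cong[OF refl], clarify) (rule sum_signed_reversal[OF _ signed_permsD(1)[OF \<sigma>], of _ _ h, OF _ h])
    also have "\<dots> = (\<Sum>p<n. \<Sum>(i, j) \<in> intervals n. h (\<sigma> ! p) * ?g i j p)"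
      unfolding case_prod_unfold by (rule sum.swap)
    also have "\<dots> = (\<Sum>p<n. h (\<sigma> ! p) * (\<Sum>(i, j) \<in> intervals n. ?g i j p))"
      by (simp add: sum_distrib_left case_prod_unfold)
    also have "\<dots> = (\<Sum>p<n. h (\<sigma> ! p) * (\<nu> * w $ p))"
      by (rule sum.cong[OF refl]) (simp add: sum_intervals_D'_X[where v = "\<lambda>k. w $ k"] row)
    also have "\<dots> = \<nu> * f \<sigma>" by (simp add: f_def sum_distrib_left mult_ac)
    finally show ?thesis .
  qed
  moreover have "\<exists>\<sigma> \<in> set vs. f \<sigma> \<noteq> 0"
  proof -
    obtain \<sigma> where \<sigma>: "\<sigma> \<in> signed_perms n" "\<And>k. k < n \<Longrightarrow> \<bar>\<sigma> ! k\<bar> = 1 \<longleftrightarrow> k = p" "\<sigma> ! p = 1"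
      using signed_perm_with_1_at[OF p(1)] by blast
    have "f \<sigma> = (\<Sum>k<n. if k = p then w $ p else 0)"
      unfolding f_def
    proof (rule sum.cong[OF refl])
      fix k assume "k \<in> {..<n}"
      then show "h (\<sigma> ! k) * w $ k = (if k = p then w $ p else 0)"
        using \<sigma>(2)[of k] \<sigma>(3) by (auto simp: h_def)
    qed
    then have "f \<sigma> = w $ p" using p(1) by simp
    then show ?thesis using \<sigma>(1) vs(2) p(2) by (intro bexI[of _ \<sigma>]) simp_all
  qed
  ultimately show "\<nu> \<in> spectrum (adjacency_mat vs (SR_adj n))"
    using spectrum_adjacency_mat_iff[OF vs(1)] by blast
qed

section \<open>The eigenvalues of the reversal graph\<close>

lemma map_nat_abs_signed_perms:
  assumes "\<sigma> \<in> signed_perms n"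
  shows "map (\<lambda>x. nat \<bar>x\<bar>) \<sigma> \<in> permutations_of_set {1..n}"
proof (rule permutations_of_setI)
  have s: "map abs \<sigma> \<in> permutations_of_set {1..int n}" using assms by (simp add: signed_perms_def)
  have e: "map (\<lambda>x. nat \<bar>x\<bar>) \<sigma> = map nat (map abs \<sigma>)" by simp
  show "set (map (\<lambda>x. nat \<bar>x\<bar>) \<sigma>) = {1..n}"
    unfolding e set_map[of nat] permutations_of_setD(1)[OF s]
    by (auto simp: image_iff intro!: bexI[of _ "int _"])
  show "distinct (map (\<lambda>x. nat \<bar>x\<bar>) \<sigma>)"
    unfolding e distinct_map[of nat] permutations_of_setD(1)[OF s]
    using permutations_of_setD(2)[OF s] by (auto simp: inj_on_def)
qed

lemma map_int_signed_perms:
  assumes "\<pi> \<in> permutations_of_set {1..n}"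
  shows "map int \<pi> \<in> signed_perms n"
  using permutations_of_setD[OF assms]
  by (auto simp: signed_perms_def comp_def distinct_map image_int_atLeastAtMost
      intro!: permutations_of_setI)

text \<open>
  The shift by \<open>n\<close> comes from the \<open>n\<close> signed reversals of a single entry, which are invisible after
  taking absolute values.
\<close>

lemma spectrum_R_plus_n_SR:
  assumes vs: "distinct vs" "set vs = signed_perms n"
    and ws: "distinct ws" "set ws = permutations_of_set {1..n}"
    and \<mu>: "\<mu> \<in> spectrum (adjacency_mat ws (R_adj n))"
  shows "\<mu> + of_nat n \<in> spectrum (adjacency_mat vs (SR_adj n))"
proof -
  obtain g where g0: "\<exists>\<pi> \<in> set ws. g \<pi> \<noteq> 0"
    and g: "\<And>\<pi>. \<pi> \<in> set ws \<Longrightarrow> (\<Sum>\<rho> | \<rho> \<in> set ws \<and> R_adj n \<pi> \<rho>. g \<rho>) = \<mu> * g \<pi>"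
    using \<mu> unfolding spectrum_adjacency_mat_iff[OF ws(1)] by blast
  define u :: "int list \<Rightarrow> nat list" where "u = map (\<lambda>x. nat \<bar>x\<bar>)"
  have "(\<Sum>\<tau> | \<tau> \<in> set vs \<and> SR_adj n \<sigma> \<tau>. g (u \<tau>)) = (\<mu> + of_nat n) * g (u \<sigma>)"
    if "\<sigma> \<in> set vs" for \<sigma>
  proof -
    have \<sigma>: "\<sigma> \<in> signed_perms n" using that vs(2) by simp
    have u: "u \<sigma> \<in> permutations_of_set {1..n}"
      unfolding u_def by (rule map_nat_abs_signed_perms[OF \<sigma>])
    let ?G = "\<lambda>(i, j). g (reversal (Suc i) (Suc j) (u \<sigma>))"
    let ?I = "{(i, j) \<in> intervals n. i \<noteq> j}"
    have "(\<Sum>\<tau> | \<tau> \<in> set vs \<and> SR_adj n \<sigma> \<tau>. g (u \<tau>)) = sum ?G (intervals n)"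
      unfolding vs(2) sum_SR_neighbours[OF \<sigma>]
      by (simp add: u_def map_signed_reversal case_prod_unfold)
    also have "intervals n = ?I \<union> (\<lambda>i. (i, i)) ` {..<n}" by (auto simp: intervals_def)
    also have "sum ?G \<dots> = sum ?G ?I + sum ?G ((\<lambda>i. (i, i)) ` {..<n})"
      by (rule sum.union_disjoint) (auto intro: finite_subset[OF _ finite_intervals])
    also have "sum ?G ?I = \<mu> * g (u \<sigma>)"
      using g[of "u \<sigma>"] u sum_R_neighbours[OF u, of g] unfolding ws(2) by simp
    also have "sum ?G ((\<lambda>i. (i, i)) ` {..<n}) = (\<Sum>i<n. ?G (i, i))"
      by (simp add: sum.reindex inj_on_def)
    also have "\<dots> = (\<Sum>i<n. g (u \<sigma>))"
    proof (rule sum.cong[OF refl])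
      fix i assume "i \<in> {..<n}"
      then have "reversal (Suc i) (Suc i) (u \<sigma>) = u \<sigma>"
        using length_finite_permutations_of_set[OF u]
        by (intro nth_equalityI) (auto simp: length_reversal nth_reversal)
      then show "?G (i, i) = g (u \<sigma>)" by simp
    qed
    finally show ?thesis by (simp add: algebra_simps)
  qed
  moreover have "\<exists>\<sigma> \<in> set vs. g (u \<sigma>) \<noteq> 0"
  proof -
    obtain \<pi> where \<pi>: "\<pi> \<in> permutations_of_set {1..n}" "g \<pi> \<noteq> 0" using g0 ws(2) by auto
    have "u (map int \<pi>) = \<pi>" by (simp add: u_def comp_def)
    then show ?thesis using \<pi> map_int_signed_perms vs(2) by metis
  qed
  ultimately show ?thesis
    unfolding spectrum_adjacency_mat_iff[OF vs(1)]
    by (intro exI[of _ "\<lambda>\<sigma>. g (u \<sigma>)"]) blast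
qed

section \<open>Eigenvalues of the signed reversal graph\<close>

theorem proposition5p1:
  fixes n :: nat and vs :: "int list list" and ws :: "nat list list"
  assumes "n \<ge> 1"
    and "distinct vs" and "set vs = signed_perms n"
    and "distinct ws" and "set ws = permutations_of_set {1..n}"
  shows "spectrum (D'_mat n + X_mat n) \<subseteq> spectrum (adjacency_mat vs (SR_adj n)) \<and>
    spectrum (D'_mat n - X_mat n) \<subseteq> spectrum (adjacency_mat vs (SR_adj n)) \<and>
    (\<forall>\<mu> \<in> spectrum (adjacency_mat ws (R_adj n)).
       \<mu> + of_nat n \<in> spectrum (adjacency_mat vs (SR_adj n)))"
proof (intro conjI ballI)
  have D: "D'_mat n \<in> carrier_mat n n" using is_D'_D'_mat[of n] by (simp add: is_D'_def)
  have X: "X_mat n \<in> carrier_mat n n" by (simp add: X_mat_def)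
  have "D'_mat n + X_mat n = D'_mat n + 1 \<cdot>\<^sub>m X_mat n"
    using D X by (intro eq_matI) simp_all
  then show "spectrum (D'_mat n + X_mat n) \<subseteq> spectrum (adjacency_mat vs (SR_adj n))"
    using spectrum_D'_X_subset_SR[OF assms(2,3), of 1] by simp
  have "D'_mat n - X_mat n = D'_mat n + (-1) \<cdot>\<^sub>m X_mat n"
    using D X by (intro eq_matI) simp_all
  then show "spectrum (D'_mat n - X_mat n) \<subseteq> spectrum (adjacency_mat vs (SR_adj n))"
    using spectrum_D'_X_subset_SR[OF assms(2,3), of "-1"] by simp
  show "\<mu> + of_nat n \<in> spectrum (adjacency_mat vs (SR_adj n))"
    if "\<mu> \<in> spectrum (adjacency_mat ws (R_adj n))" for \<mu>
    by (rule spectrum_R_plus_n_SR[OF assms(2-5) that])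
qed

end
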